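(* Let $\varphi\in\Phi$ and $\psi\in\Phi$. If $\psi$ is convex on $(0,+\infty)$ and $\lim_{x\to 0^+}\bigl(\varphi(x)-\psi(x)\bigr)=+\infty$, then $$\lim_{x\to 0^+}\bigl(\varphi^{**}(x)-\psi(x)\bigr)=+\infty.$$
   Context: $\Phi$ is the set of all functions $\varphi:(0,+\infty)\to\mathbb{R}$ (no continuity assumed) for which there exists a real number $a$ with $\inf_{x\in(0,+\infty)}(\varphi(x)-ax)>-\infty$. For $\varphi\in\Phi$ let $M_\varphi=\{(a,b)\in\mathbb{R}^2 : \inf_{t\in(0,+\infty)}(\varphi(t)-at)>b\}$, and define $\varphi^{**}:(0,+\infty)\to\mathbb{R}$ by $\varphi^{**}(x)=\sup_{(a,b)\in M_\varphi}(ax+b)$. *)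

theory Defs
  imports "HOL-Analysis.Analysis"
begin

text \<open>
  A function on $(0,+\infty)$ is represented by a total function of type \<open>real \<Rightarrow> real\<close>; only its
  values on \<open>{0<..}\<close> enter the definitions below. Infima that may equal $-\infty$ are taken in
  \<open>ereal\<close>, because \<open>Inf\<close> on \<open>real\<close> is unspecified for sets not bounded below.
\<close>

definition Phi :: "(real \<Rightarrow> real) set" where
  "Phi = {\<phi>. \<exists>a::real. (INF x\<in>{0<..}. ereal (\<phi> x - a * x)) > -\<infinity>}"

definition minorants :: "(real \<Rightarrow> real) \<Rightarrow> (real \<times> real) set" where
  "minorants \<phi> = {(a, b). (INF t\<in>{0<..}. ereal (\<phi> t - a * t)) > ereal b}"

text \<open>
  The supremum is taken in \<open>real\<close>: for \<open>\<phi> \<in> Phi\<close> and \<open>x > 0\<close> it ranges over a nonempty set bounded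
  above by \<open>\<phi> x\<close>.
\<close>

definition biconjugate :: "(real \<Rightarrow> real) \<Rightarrow> real \<Rightarrow> real" where
  "biconjugate \<phi> x = (SUP (a, b)\<in>minorants \<phi>. a * x + b)"

end

theory Submission
  imports Defs
begin

text \<open>
  Fix \<open>K\<close>, choose \<open>d\<close> with \<open>\<phi> \<ge> \<psi> + K + 2\<close> on \<open>(0, d)\<close>, and let \<open>l\<close> be a supporting line of \<open>\<psi>\<close> at
  a point \<open>x < d\<close>. Monotonicity of subgradients puts \<open>l\<close> below the supporting line at \<open>d\<close> on
  \<open>[d, \<infinity>)\<close>. As \<open>\<phi>\<close> has an affine minorant there, one slope \<open>n \<ge> 0\<close>, independent of \<open>x\<close>, makes
  \<open>l(t) + K + 2 - n t\<close> a minorant of \<open>\<phi>\<close> on the whole half-line. At \<open>t = x\<close> the correction costs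
  only \<open>n x\<close>, which is at most 1 near 0.
\<close>

lemma PhiE:
  assumes "\<phi> \<in> Phi"
  obtains a b where "\<And>t. t > 0 \<Longrightarrow> a * t + b \<le> \<phi> t"
proof -
  obtain a where "(INF x\<in>{0<..}. ereal (\<phi> x - a * x)) > -\<infinity>"
    using assms by (auto simp: Phi_def)
  then obtain b where b: "ereal b < (INF x\<in>{0<..}. ereal (\<phi> x - a * x))"
    using ereal_dense2 by blast
  have "a * t + b \<le> \<phi> t" if "t > 0" for t
    using less_INF_D[OF b, of t] that by simp
  then show thesis by (rule that)
qed

lemma minorants_le:
  assumes "(a, b) \<in> minorants \<phi>" "t > 0"
  shows "a * t + b \<le> \<phi> t"
proof -
  have "ereal b < (INF t\<in>{0<..}. ereal (\<phi> t - a * t))"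
    using assms by (simp add: minorants_def)
  from less_INF_D[OF this, of t] assms(2) show ?thesis by simp
qed

lemma minorantsI:
  assumes "\<And>t. t > 0 \<Longrightarrow> a * t + c \<le> \<phi> t" "b < c"
  shows "(a, b) \<in> minorants \<phi>"
proof -
  have "ereal c \<le> (INF t\<in>{0<..}. ereal (\<phi> t - a * t))"
    using assms(1) by (intro INF_greatest) (auto simp: le_diff_eq add.commute)
  with assms(2) show ?thesis
    by (auto simp: minorants_def intro: less_le_trans[of "ereal b" "ereal c"])
qed

lemma minorants_le_biconjugate:
  assumes "(a, b) \<in> minorants \<phi>" "x > 0"
  shows "a * x + b \<le> biconjugate \<phi> x"
proof -
  have "bdd_above ((\<lambda>(a, b). a * x + b) ` minorants \<phi>)"
    using minorants_le[OF _ assms(2)] by (auto intro!: bdd_aboveI2[of _ _ "\<phi> x"])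
  from cSUP_upper[OF assms(1) this] show ?thesis by (simp add: biconjugate_def)
qed

text \<open>The slope can be taken as the right derivative at \<open>x\<close>, the infimum of the
  secant slopes from \<open>x\<close> to points of \<open>A\<close> on its right.\<close>

lemma convex_on_subgradient:
  fixes f :: "real \<Rightarrow> real"
  assumes "convex_on A f" "x \<in> interior A"
  obtains s where "\<And>t. t \<in> A \<Longrightarrow> f x + s * (t - x) \<le> f t"
proof -
  have "f x + Inf ((\<lambda>t. (f x - f t) / (x - t)) ` ({x<..} \<inter> A)) * (t - x) \<le> f t" if "t \<in> A" for t
    using convex_le_Inf_differential[OF assms that] by (simp add: field_simps)
  then show thesis by (rule that)
qed

theorem theorem3p2:
  fixes \<phi> \<psi> :: "real \<Rightarrow> real"
  assumes "\<phi> \<in> Phi"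
    and "\<psi> \<in> Phi"
    and "convex_on {0<..} \<psi>"
    and "filterlim (\<lambda>x. \<phi> x - \<psi> x) at_top (at_right 0)"
  shows "filterlim (\<lambda>x. biconjugate \<phi> x - \<psi> x) at_top (at_right 0)"
  unfolding filterlim_at_top
proof
  fix K :: real
  have subgradient: "\<exists>s. \<forall>t>0. \<psi> x + s * (t - x) \<le> \<psi> t" if "x > 0" for x
    using convex_on_subgradient[OF assms(3), of x] that by (auto simp: interior_open)
  obtain a b where ab: "\<And>t. t > 0 \<Longrightarrow> a * t + b \<le> \<phi> t"
    using PhiE[OF assms(1)] by blast
  \<comment> \<open>Of the two spare units, one pays for the strict inequality in
    \<open>minorants\<close>, the other for \<open>n * x\<close>.\<close>
  have "eventually (\<lambda>x. K + 2 \<le> \<phi> x - \<psi> x) (at_right 0)"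
    using assms(4) by (simp add: filterlim_at_top)
  then obtain d where d: "d > 0" "\<And>t. 0 < t \<Longrightarrow> t < d \<Longrightarrow> K + 2 \<le> \<phi> t - \<psi> t"
    by (auto simp: eventually_at_right_field)
  obtain S where S: "\<And>t. t > 0 \<Longrightarrow> \<psi> d + S * (t - d) \<le> \<psi> t"
    using subgradient[OF d(1)] by blast
  \<comment> \<open>The supporting line at \<open>d\<close>, raised by \<open>K + 2\<close>, exceeds
    \<open>a * t + b\<close> by \<open>(S - a) * t + P\<close>; for \<open>t \<ge> d\<close> this is
    at most \<open>n * t\<close>.\<close>
  define P where "P = \<psi> d - S * d + K + 2 - b"
  define n where "n = \<bar>S - a\<bar> + \<bar>P\<bar> / d"
  have n: "n \<ge> 0" using d(1) by (simp add: n_def)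
  have "K \<le> biconjugate \<phi> x - \<psi> x" if x: "0 < x" "x < min d (1 / (n + 1))" for x
  proof -
    obtain s where s: "\<And>t. t > 0 \<Longrightarrow> \<psi> x + s * (t - x) \<le> \<psi> t"
      using subgradient[OF x(1)] by blast
    \<comment> \<open>Sum of the two support inequalities, each line evaluated at the other's base
      point.\<close>
    have "(s - S) * (d - x) \<le> 0"
      using s[OF d(1)] S[OF x(1)] by (simp add: algebra_simps)
    then have sS: "s \<le> S" using x by (simp add: mult_le_0_iff)
    have "(s - n) * t + (\<psi> x - s * x + K + 2) \<le> \<phi> t" if t: "t > 0" for t
    proof (cases "t < d")
      case True
      have "0 \<le> n * t" using n t by simp
      with d(2)[OF t True] s[OF t] show ?thesis by (simp add: algebra_simps)
    next
      case False
      \<comment> \<open>Splitting \<open>t - x\<close> at \<open>d\<close> bounds the line at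
        \<open>x\<close> by the line at \<open>d\<close>.\<close>
      have "s * (t - d) \<le> S * (t - d)"
        using sS False by (intro mult_right_mono) auto
      moreover have "\<psi> x + s * (d - x) \<le> \<psi> d" using s[OF d(1)] .
      moreover have "(S - a) * t \<le> \<bar>S - a\<bar> * t"
        using t by (intro mult_right_mono) auto
      moreover have "P \<le> \<bar>P\<bar> / d * t"
      proof -
        have "\<bar>P\<bar> / d * d \<le> \<bar>P\<bar> / d * t"
          using False d(1) by (intro mult_left_mono) auto
        then show ?thesis using d(1) by simp
      qed
      moreover have "n * t = \<bar>S - a\<bar> * t + \<bar>P\<bar> / d * t" by (simp add: n_def distrib_right)
      ultimately show ?thesis using ab[OF t] by (simp add: P_def algebra_simps)
    qed
    then have "(s - n, \<psi> x - s * x + K + 1) \<in> minorants \<phi>"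
      by (rule minorantsI) auto
    from minorants_le_biconjugate[OF this x(1)]
    have "\<psi> x + K + 1 - n * x \<le> biconjugate \<phi> x" by (simp add: algebra_simps)
    moreover have "n * x \<le> 1"
      using x n by (simp add: field_simps)
    ultimately show ?thesis by simp
  qed
  moreover have "min d (1 / (n + 1)) > 0" using d(1) n by simp
  ultimately show "eventually (\<lambda>x. K \<le> biconjugate \<phi> x - \<psi> x) (at_right 0)"
    unfolding eventually_at_right_field by blast
qed

end
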